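(* Assume $K(f,g)<\infty$. Let $\mathcal{R}$ be the class of all positive functions $r$ defined on $\mathbb{R}$ such that $x\mapsto g(x)r(a^\top x)$ is a density on $\mathbb{R}^d$ for all $a\in\mathbb{R}^d_*$. There exists a vector $a\in\mathbb{R}^d_*$ such that $$\arg\min_{r\in\mathcal{R}}K(f,gr)=\frac{f_a}{g_a},\qquad r(a^\top x)=\frac{f_a(a^\top x)}{g_a(a^\top x)},$$ where $gr$ denotes $x\mapsto g(x)r(a^\top x)$ and the $r$ in the second equality is the minimiser, as well as $$K(f,g)=K(f_a,g_a)+K\Big(f,g\frac{f_a}{g_a}\Big).$$
   Context: $\mathbb{R}^d_*$ is the set of nonzero vectors of $\mathbb{R}^d$. If $h$ is the density of a random vector $Z$ in $\mathbb{R}^d$, $h_a$ denotes the density of $a^\top Z$ on $\mathbb{R}$; $g\frac{f_a}{g_a}$ denotes $x\mapsto g(x)\frac{f_a(a^\top x)}{g_a(a^\top x)}$. $K(p,q)=\int p\ln(p/q)$ is the relative entropy (Kullback-Leibler divergence), $+\infty$ when absolute continuity fails. $f$ is a density on $\mathbb{R}^d$ and $g$ is an elliptical density on $\mathbb{R}^d$ with the same mean and variance as $f$; elliptical means of the form $\frac{c_d}{|\Sigma|^{1/2}}\xi_d(\frac12(x-\mu)^\top\Sigma^{-1}(x-\mu))$ with $\mu\in\mathbb{R}^d$, $\Sigma$ a $d\times d$ positive-definite matrix, $\xi_d$ a function called the density generator, and $c_d$ a normalising constant.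
   Formalization: The class R is taken for the vector a of the conclusion only: g(x)r(a^T x) must be a density for that a, not for all a, since otherwise f_a/g_a is in general not in R; "positive" means nonnegative, and equality of the minimiser with f_a/g_a is almost everywhere. *)

theory Defs
  imports "HOL-Probability.Probability"
begin

definition prob_density :: "('a::euclidean_space \<Rightarrow> real) \<Rightarrow> bool" where
  "prob_density h \<longleftrightarrow>
     h \<in> borel_measurable borel \<and> (\<forall>x. 0 \<le> h x) \<and> (\<integral>\<^sup>+ x. ennreal (h x) \<partial>lborel) = 1"

abbreviation law :: "('a::euclidean_space \<Rightarrow> real) \<Rightarrow> 'a measure" where
  "law h \<equiv> density lborel (\<lambda>x. ennreal (h x))"

(* The library's KL_divergence is real-valued and returns a junk value when the
   divergence is infinite, hence this extended-real version.  The integral of p ln (p/q) is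
   written as positive part minus negative part; the latter is finite whenever p and q
   are probability densities.  Points with p = 0 contribute 0. *)
definition KL :: "('a::euclidean_space \<Rightarrow> real) \<Rightarrow> ('a \<Rightarrow> real) \<Rightarrow> ereal" where
  "KL p q =
     (if absolutely_continuous (law q) (law p)
      then enn2ereal (\<integral>\<^sup>+ x. ennreal (p x * ln (p x / q x)) \<partial>lborel)
         - enn2ereal (\<integral>\<^sup>+ x. ennreal (- (p x * ln (p x / q x))) \<partial>lborel)
      else \<infinity>)"

(* h_a, the Lebesgue density of the random variable a . Z for Z with density h; like any
   density it is determined only up to null sets, and RN_deriv selects a version. *)
definition proj_density :: "('a::euclidean_space \<Rightarrow> real) \<Rightarrow> 'a \<Rightarrow> real \<Rightarrow> real" where
  "proj_density h a t = enn2real (RN_deriv lborel (distr (law h) lborel (\<lambda>x. a \<bullet> x)) t)"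

definition ridge_mult :: "('a::euclidean_space \<Rightarrow> real) \<Rightarrow> 'a \<Rightarrow> (real \<Rightarrow> real) \<Rightarrow> 'a \<Rightarrow> real" where
  "ridge_mult g a r = (\<lambda>x. g x * r (a \<bullet> x))"

(* The quotient vanishes where g_a does (x / 0 = 0); this affects only a g_a-null set. *)
definition proj_ratio :: "('a::euclidean_space \<Rightarrow> real) \<Rightarrow> ('a \<Rightarrow> real) \<Rightarrow> 'a \<Rightarrow> real \<Rightarrow> real" where
  "proj_ratio f g a = (\<lambda>t. proj_density f a t / proj_density g a t)"

(* The class is taken direction by direction: f_a / g_a normalises g in the direction a
   but in general in no other direction.  "Positive" means nonnegative, because
   f_a / g_a vanishes wherever f_a does. *)
definition ridge_class :: "('a::euclidean_space \<Rightarrow> real) \<Rightarrow> 'a \<Rightarrow> (real \<Rightarrow> real) set" where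
  "ridge_class g a =
     {r. r \<in> borel_measurable borel \<and> (\<forall>t. 0 \<le> r t) \<and> prob_density (ridge_mult g a r)}"

definition pos_def :: "real ^ 'n ^ 'n \<Rightarrow> bool" where
  "pos_def S \<longleftrightarrow> transpose S = S \<and> (\<forall>x. x \<noteq> 0 \<longrightarrow> 0 < x \<bullet> (S *v x))"

definition elliptical_density :: "(real ^ 'n \<Rightarrow> real) \<Rightarrow> bool" where
  "elliptical_density g \<longleftrightarrow> prob_density g \<and>
     (\<exists>(\<mu> :: real ^ 'n) (\<Sigma> :: real ^ 'n ^ 'n) (c :: real) (\<xi> :: real \<Rightarrow> real). pos_def \<Sigma> \<and>
        (\<forall>x. g x = c / sqrt (det \<Sigma>) * \<xi> (1 / 2 * ((x - \<mu>) \<bullet> (matrix_inv \<Sigma> *v (x - \<mu>))))))"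

definition finite_variance :: "(real ^ 'n \<Rightarrow> real) \<Rightarrow> bool" where
  "finite_variance h \<longleftrightarrow> integrable (law h) (\<lambda>x. (norm x)\<^sup>2)"

definition mean :: "(real ^ 'n \<Rightarrow> real) \<Rightarrow> real ^ 'n" where
  "mean h = (\<integral> x. x \<partial>law h)"

definition covariance :: "(real ^ 'n \<Rightarrow> real) \<Rightarrow> real ^ 'n ^ 'n" where
  "covariance h = (\<chi> i j. \<integral> x. (x $ i - mean h $ i) * (x $ j - mean h $ j) \<partial>law h)"

end

theory Submission imports Defs begin

text \<open>Any nonzero direction \<open>a\<close> will do. Write
  \<open>\<rho> = f\<^sub>a / g\<^sub>a\<close>. The chain rule is the integral against \<open>f\<close> of
  \<open>ln (f/g) = ln (\<rho> (a \<bullet> x)) + ln (f / (g \<rho>))\<close>, where the first summand is integrable because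
  both summands have integrable negative parts and the left-hand side is integrable.
  For a competitor \<open>r\<close>, put \<open>s = r/\<rho>\<close>; then \<open>\<integral> f s \<le> \<integral> g\<^sub>a r = 1\<close>, and integrating
  \<open>ln s \<le> s - 1\<close> gives \<open>K(f, g r) \<ge> K(f, g \<rho>)\<close>. Equality forces \<open>s = 1\<close> almost everywhere under
  \<open>f\<close>, so \<open>g\<^sub>a r \<ge> f\<^sub>a\<close>, and both sides have integral 1.\<close>

text \<open>The integral of the indicator of \<open>{x. a \<bullet> x \<in> N}\<close> is invariant under \<open>x \<mapsto> x + t a\<close>. Averaging over
  \<open>t\<close> and exchanging the integrals leaves the measure of an affine image of the null set \<open>N\<close>.\<close>

lemma AE_lborel_inner:
  fixes a :: "'a::euclidean_space"
  assumes "a \<noteq> 0" and P: "AE t in lborel. P (t::real)"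
  shows "AE x in lborel. P (a \<bullet> x)"
proof -
  from P obtain N :: "real set"
    where sub: "{t. \<not> P t} \<subseteq> N" and N: "N \<in> null_sets lborel"
    by (auto simp: eventually_ae_filter)
  then have [measurable]: "N \<in> sets borel"
    by (auto simp: null_sets_def)
  let ?B = "\<lambda>x::'a. indicator N (a \<bullet> x) :: ennreal"
  have aa: "a \<bullet> a \<noteq> 0"
    using assms by simp
  have shift: "(\<integral>\<^sup>+x. ?B x \<partial>lborel) = (\<integral>\<^sup>+x. indicator N (a \<bullet> x + t * (a \<bullet> a)) \<partial>lborel)" for t
  proof -
    have "(\<integral>\<^sup>+x. ?B x \<partial>lborel) = (\<integral>\<^sup>+x. ?B x \<partial>distr lborel borel ((+) (t *\<^sub>R a)))"
      by (simp only: lborel_distr_plus)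
    also have "\<dots> = (\<integral>\<^sup>+x. ?B (t *\<^sub>R a + x) \<partial>lborel)"
      by (subst nn_integral_distr) simp_all
    finally show ?thesis
      by (simp add: inner_add_right add.commute)
  qed
  have null: "(\<integral>\<^sup>+t. indicator N (u + t * (a \<bullet> a)) \<partial>lborel) = (0::ennreal)" for u
  proof -
    have "AE t in lborel. t \<notin> N"
      using N by (rule AE_not_in)
    then have "AE t in lborel. u + (a \<bullet> a) * t \<notin> N"
      by (intro AE_borel_affine[OF aa]) simp_all
    then have "AE t in lborel. (indicator N (u + t * (a \<bullet> a)) :: ennreal) = 0"
      by eventually_elim (simp add: mult.commute)
    then show ?thesis
      by (subst nn_integral_0_iff_AE) simp_all
  qed
  \<comment> \<open>The interval has length 1, so inserting it turns a fixed integral into an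
    average over \<open>t\<close>. Enlarging it to the whole line gives an upper bound, which
    suffices because that bound is 0.\<close>
  have "(\<integral>\<^sup>+x. ?B x \<partial>lborel) = (\<integral>\<^sup>+t. (\<integral>\<^sup>+x. ?B x \<partial>lborel) * indicator {0..1::real} t \<partial>lborel)"
    by (subst nn_integral_cmult_indicator) simp_all
  also have "\<dots> \<le> (\<integral>\<^sup>+t. (\<integral>\<^sup>+x. ?B x \<partial>lborel) \<partial>(lborel :: real measure))"
    by (intro nn_integral_mono) (simp split: split_indicator)
  also have "\<dots> = (\<integral>\<^sup>+t. (\<integral>\<^sup>+x. indicator N (a \<bullet> x + t * (a \<bullet> a)) \<partial>lborel) \<partial>lborel)"
    by (intro nn_integral_cong shift)
  also have "\<dots> = (\<integral>\<^sup>+x. (\<integral>\<^sup>+t. indicator N (a \<bullet> x + t * (a \<bullet> a)) \<partial>lborel) \<partial>lborel)"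
    by (rule lborel_pair.Fubini') simp
  finally have "(\<integral>\<^sup>+x. ?B x \<partial>lborel) = 0"
    by (simp add: null)
  then have "AE x in lborel. ?B x = 0"
    by (subst (asm) nn_integral_0_iff_AE) simp_all
  then show ?thesis
    by eventually_elim (use sub in \<open>auto simp: indicator_def split: if_splits\<close>)
qed

section \<open>Probability densities and absolute continuity of their laws\<close>

lemma prob_density_measurable [measurable_dest]:
  "prob_density h \<Longrightarrow> h \<in> borel_measurable borel"
  by (simp add: prob_density_def)

lemma prob_density_nonneg: "prob_density h \<Longrightarrow> 0 \<le> h x"
  by (simp add: prob_density_def)

lemma prob_density_nn_integral: "prob_density h \<Longrightarrow> (\<integral>\<^sup>+x. ennreal (h x) \<partial>lborel) = 1"
  by (simp add: prob_density_def)

lemma prob_space_law: "prob_density h \<Longrightarrow> prob_space (law h)"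
  by (intro prob_spaceI) (simp add: emeasure_density prob_density_nn_integral cong: nn_integral_cong)

lemma AE_law_iff:
  "h \<in> borel_measurable borel \<Longrightarrow> (AE x in law h. P x) \<longleftrightarrow> (AE x in lborel. 0 < h x \<longrightarrow> P x)"
  by (simp add: AE_density)

lemma AE_law_pos: "h \<in> borel_measurable borel \<Longrightarrow> AE x in law h. 0 < h x"
  by (simp add: AE_law_iff)

text \<open>\<open>q\<close> is positive almost everywhere under its own law, and absolute
  continuity transfers this to \<open>law p\<close>. Conversely, \<open>q\<close> vanishes almost
  everywhere on a \<open>law q\<close>-null set, hence so does \<open>p\<close>.\<close>

lemma absolutely_continuous_law_iff:
  assumes [measurable]: "p \<in> borel_measurable borel" "q \<in> borel_measurable borel"
  shows "absolutely_continuous (law q) (law p) \<longleftrightarrow> (AE x in law p. 0 < q x)"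
proof
  assume "absolutely_continuous (law q) (law p)"
  then show "AE x in law p. 0 < q x"
    by (rule absolutely_continuous_AE[rotated]) (simp_all add: AE_law_pos)
next
  assume *: "AE x in law p. 0 < q x"
  show "absolutely_continuous (law q) (law p)"
    unfolding absolutely_continuous_def
  proof
    fix A assume "A \<in> null_sets (law q)"
    then have A: "A \<in> sets borel" "AE x in lborel. x \<in> A \<longrightarrow> ennreal (q x) = 0"
      by (simp_all add: null_sets_density_iff)
    have "AE x in lborel. x \<in> A \<longrightarrow> ennreal (p x) = 0"
      using A(2) *[unfolded AE_law_iff[OF assms(1)]]
      by eventually_elim (auto simp: ennreal_eq_0_iff not_less[symmetric])
    with A show "A \<in> null_sets (law p)"
      by (simp add: null_sets_density_iff)
  qed
qed

section \<open>Marginal densities along a direction\<close>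

text \<open>\<open>RN_deriv\<close> represents the law of \<open>a \<bullet> x\<close> once that law
  is absolutely continuous, which holds because preimages of null sets under
  \<open>a \<bullet> x\<close> are null (\<open>AE_lborel_inner\<close>).\<close>

lemma law_proj_density:
  assumes h: "prob_density h" and "a \<noteq> 0"
  shows "law (proj_density h a) = distr (law h) lborel (\<lambda>x. a \<bullet> x)"
proof -
  note [measurable] = prob_density_measurable[OF h]
  let ?D = "distr (law h) lborel (\<lambda>x. a \<bullet> x)"
  interpret D: prob_space ?D
    by (intro prob_space.prob_space_distr prob_space_law h) simp
  have ac: "absolutely_continuous lborel ?D"
    unfolding absolutely_continuous_def
  proof
    fix N :: "real set" assume N: "N \<in> null_sets lborel"
    then have [measurable]: "N \<in> sets borel"
      by (auto simp: null_sets_def)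
    have "AE x in lborel. a \<bullet> x \<notin> N"
      using \<open>a \<noteq> 0\<close> AE_not_in[OF N] by (rule AE_lborel_inner)
    then have "AE x in law h. a \<bullet> x \<notin> N"
      by (auto simp: AE_law_iff elim: eventually_mono)
    then have "AE t in ?D. t \<notin> N"
      by (subst AE_distr_iff) simp_all
    then show "N \<in> null_sets ?D"
      by (subst AE_iff_null_sets) simp_all
  qed
  \<comment> \<open>\<open>enn2real\<close> sends infinity to 0, so finiteness almost everywhere
    ensures that the real-valued version still has the same law.\<close>
  have "AE t in lborel. RN_deriv lborel ?D t \<noteq> \<infinity>"
    by (intro sigma_finite_measure.RN_deriv_finite[OF sigma_finite_lborel] D.sigma_finite_measure_axioms ac) simp
  then have "AE t in lborel. ennreal (proj_density h a t) = RN_deriv lborel ?D t"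
    by eventually_elim (simp add: proj_density_def less_top)
  then have "law (proj_density h a) = density lborel (RN_deriv lborel ?D)"
    by (intro density_cong) (simp_all add: proj_density_def)
  also have "\<dots> = ?D"
    by (intro sigma_finite_measure.density_RN_deriv[OF sigma_finite_lborel] ac) simp
  finally show ?thesis .
qed

lemma measurable_proj_density [measurable]: "proj_density h a \<in> borel_measurable borel"
  unfolding proj_density_def by simp

lemma proj_density_nonneg: "0 \<le> proj_density h a t"
  by (simp add: proj_density_def)

lemma prob_density_proj_density:
  assumes h: "prob_density h" and "a \<noteq> 0"
  shows "prob_density (proj_density h a)"
proof -
  note [measurable] = prob_density_measurable[OF h]
  interpret prob_space "law (proj_density h a)"
    unfolding law_proj_density[OF assms]
    by (intro prob_space.prob_space_distr prob_space_law h) simp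
  have "(\<integral>\<^sup>+t. ennreal (proj_density h a t) \<partial>lborel) = 1"
    using emeasure_space_1 by (simp add: emeasure_density cong: nn_integral_cong)
  then show ?thesis
    by (simp add: prob_density_def proj_density_nonneg)
qed

lemma
  assumes h: "prob_density h" and a: "a \<noteq> 0"
  shows AE_law_proj_density_iff:
      "Measurable.pred borel P \<Longrightarrow>
        (AE t in law (proj_density h a). P t) \<longleftrightarrow> (AE x in law h. P (a \<bullet> x))"
    and nn_integral_law_proj_density:
      "u \<in> borel_measurable borel \<Longrightarrow>
        (\<integral>\<^sup>+t. u t \<partial>law (proj_density h a)) = (\<integral>\<^sup>+x. u (a \<bullet> x) \<partial>law h)"
    and integral_law_proj_density:
      "v \<in> borel_measurable borel \<Longrightarrow>
        (\<integral>t. v t \<partial>law (proj_density h a)) = (\<integral>x. (v (a \<bullet> x) :: real) \<partial>law h)"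
proof -
  note [measurable] = prob_density_measurable[OF h]
  show "(AE t in law (proj_density h a). P t) \<longleftrightarrow> (AE x in law h. P (a \<bullet> x))"
    if [measurable]: "Measurable.pred borel P"
    unfolding law_proj_density[OF assms] by (subst AE_distr_iff) simp_all
  show "(\<integral>\<^sup>+t. u t \<partial>law (proj_density h a)) = (\<integral>\<^sup>+x. u (a \<bullet> x) \<partial>law h)"
    if [measurable]: "u \<in> borel_measurable borel"
    unfolding law_proj_density[OF assms] by (subst nn_integral_distr) simp_all
  show "(\<integral>t. v t \<partial>law (proj_density h a)) = (\<integral>x. v (a \<bullet> x) \<partial>law h)"
    if [measurable]: "v \<in> borel_measurable borel"
    unfolding law_proj_density[OF assms] by (subst integral_distr) simp_all
qed

section \<open>Relative entropy as an integral against the first law\<close>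

text \<open>Integrating \<open>ln y \<le> y - 1\<close> at \<open>y = q x / p x\<close> against
  \<open>p\<close> bounds the negative part by the mass of \<open>q\<close>. This keeps the
  difference in \<open>KL\<close> from being infinity minus infinity.\<close>

lemma nn_integral_neg_log_ratio_le:
  assumes p: "prob_density p" and q: "prob_density q"
  shows "(\<integral>\<^sup>+x. ennreal (- ln (p x / q x)) \<partial>law p) \<le> 1"
proof -
  note [measurable] = prob_density_measurable[OF p] prob_density_measurable[OF q]
  have "p x * - ln (p x / q x) \<le> q x" for x
  proof (cases "0 < p x \<and> 0 < q x")
    case True
    have "- ln (p x / q x) = ln (q x / p x)"
      using True by (simp add: ln_div)
    also have "\<dots> \<le> q x / p x - 1"
      using True by (intro ln_le_minus_one) simp
    finally have "p x * - ln (p x / q x) \<le> p x * (q x / p x - 1)"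
      using True by (intro mult_left_mono) simp_all
    also have "\<dots> \<le> q x"
      using True by (simp add: field_simps)
    finally show ?thesis .
  next
    \<comment> \<open>Here the left-hand side is 0: either the factor \<open>p x\<close> is, or
      \<open>q x = 0\<close> and the conventions \<open>p x / 0 = 0\<close> and
      \<open>ln 0 = 0\<close> apply.\<close>
    case False
    then have "p x = 0 \<or> q x = 0"
      using prob_density_nonneg[OF p, of x] prob_density_nonneg[OF q, of x] by linarith
    then show ?thesis
      using prob_density_nonneg[OF q, of x] by auto
  qed
  then have "(\<integral>\<^sup>+x. ennreal (- ln (p x / q x)) \<partial>law p) \<le> (\<integral>\<^sup>+x. ennreal (q x) \<partial>lborel)"
    by (simp add: nn_integral_density ennreal_mult'[symmetric] prob_density_nonneg[OF p] ennreal_leI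
          nn_integral_mono)
  then show ?thesis
    by (simp add: prob_density_nn_integral[OF q])
qed

lemma KL_eq_law:
  assumes p: "prob_density p" and q: "prob_density q"
    and "AE x in law p. 0 < q x"
  shows "KL p q = enn2ereal (\<integral>\<^sup>+x. ennreal (ln (p x / q x)) \<partial>law p)
                - enn2ereal (\<integral>\<^sup>+x. ennreal (- ln (p x / q x)) \<partial>law p)"
proof -
  note [measurable] = prob_density_measurable[OF p] prob_density_measurable[OF q]
  show ?thesis
    using assms(3)
    by (simp add: KL_def absolutely_continuous_law_iff nn_integral_density ennreal_mult'[symmetric]
          prob_density_nonneg[OF p])
qed

lemma KL_eq_integral:
  assumes p: "prob_density p" and q: "prob_density q"
    and pos: "AE x in law p. 0 < q x" and int: "integrable (law p) (\<lambda>x. ln (p x / q x))"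
  shows "KL p q = ereal (\<integral>x. ln (p x / q x) \<partial>law p)"
proof -
  let ?P = "\<integral>\<^sup>+x. ennreal (ln (p x / q x)) \<partial>law p"
  let ?N = "\<integral>\<^sup>+x. ennreal (- ln (p x / q x)) \<partial>law p"
  have "?P \<noteq> \<infinity>" "?N \<noteq> \<infinity>"
    using int by (simp_all add: real_integrable_def)
  then obtain u v where "0 \<le> u" "?P = ennreal u" "0 \<le> v" "?N = ennreal v"
    by (cases ?P; cases ?N) auto
  then show ?thesis
    by (simp add: KL_eq_law[OF p q pos] real_lebesgue_integral_def[OF int])
qed

text \<open>The negative part always has integral at most 1, so a finite difference forces a finite
  positive part. From here on, extended-real values can be replaced by Bochner integrals.\<close>

lemma KL_less_infinity_iff:
  assumes p: "prob_density p" and q: "prob_density q"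
  shows "KL p q < \<infinity> \<longleftrightarrow>
    (AE x in law p. 0 < q x) \<and> integrable (law p) (\<lambda>x. ln (p x / q x))"
proof
  note [measurable] = prob_density_measurable[OF p] prob_density_measurable[OF q]
  assume fin: "KL p q < \<infinity>"
  then have pos: "AE x in law p. 0 < q x"
    by (auto simp: KL_def absolutely_continuous_law_iff split: if_splits)
  have neg: "(\<integral>\<^sup>+x. ennreal (- ln (p x / q x)) \<partial>law p) \<noteq> \<infinity>"
    using nn_integral_neg_log_ratio_le[OF p q] by (auto simp: top_unique)
  have "(\<integral>\<^sup>+x. ennreal (ln (p x / q x)) \<partial>law p) \<noteq> \<infinity>"
    using fin neg unfolding KL_eq_law[OF p q pos] by auto
  with neg pos show "(AE x in law p. 0 < q x) \<and> integrable (law p) (\<lambda>x. ln (p x / q x))"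
    by (simp add: real_integrable_def)
qed (auto simp: KL_eq_integral[OF p q])


section \<open>Reweighting \<open>g\<close> along one fixed, arbitrary nonzero direction\<close>

locale ridge_projection =
  fixes f g :: "'a::euclidean_space \<Rightarrow> real" and a :: 'a
  assumes f: "prob_density f" and g: "prob_density g"
    and a: "a \<noteq> 0" and finite_KL: "KL f g < \<infinity>"
begin

abbreviation fa where "fa \<equiv> proj_density f a"
abbreviation ga where "ga \<equiv> proj_density g a"
abbreviation \<rho> where "\<rho> \<equiv> proj_ratio f g a"

lemmas [measurable] = prob_density_measurable[OF f] prob_density_measurable[OF g]

lemma measurable_proj_ratio [measurable]: "\<rho> \<in> borel_measurable borel"
  unfolding proj_ratio_def by simp

lemma proj_ratio_nonneg: "0 \<le> \<rho> t"
  by (simp add: proj_ratio_def proj_density_nonneg)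

lemmas fa = prob_density_proj_density[OF f a]
lemmas ga = prob_density_proj_density[OF g a]

lemma
  shows AE_g_pos: "AE x in law f. 0 < g x"
    and integrable_log_ratio: "integrable (law f) (\<lambda>x. ln (f x / g x))"
  using finite_KL unfolding KL_less_infinity_iff[OF f g] by simp_all

text \<open>\<open>ga (a \<bullet> x)\<close> is positive almost everywhere under
  \<open>law g\<close>, hence under \<open>law f\<close> by absolute continuity. Thus the zeros of
  the denominator in \<open>\<rho>\<close> are invisible to \<open>f\<close>.\<close>

lemma AE_ga_pos: "AE t in law fa. 0 < ga t"
proof -
  have "AE x in law g. 0 < ga (a \<bullet> x)"
    by (subst AE_law_proj_density_iff[OF g a, symmetric]) (simp_all add: AE_law_pos)
  then have "AE x in law f. 0 < ga (a \<bullet> x)"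
    using AE_g_pos
    unfolding AE_law_iff[OF prob_density_measurable[OF f]] AE_law_iff[OF prob_density_measurable[OF g]]
    by eventually_elim simp
  then show ?thesis
    by (subst AE_law_proj_density_iff[OF f a]) simp_all
qed

lemma AE_proj_ratio_pos: "AE x in law f. 0 < \<rho> (a \<bullet> x)"
proof -
  have "AE t in law fa. 0 < \<rho> t"
    using AE_ga_pos AE_law_pos[OF measurable_proj_density]
    by eventually_elim (simp add: proj_ratio_def)
  then show ?thesis
    by (subst (asm) AE_law_proj_density_iff[OF f a]) simp_all
qed

text \<open>Since \<open>r\<close> sees \<open>x\<close> only through \<open>a \<bullet> x\<close>,
  normalisation of the reweighted density becomes a condition on the line.\<close>

lemma nn_integral_ridge_mult:
  assumes [measurable]: "r \<in> borel_measurable borel"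
  shows "(\<integral>\<^sup>+x. ennreal (ridge_mult g a r x) \<partial>lborel) = (\<integral>\<^sup>+t. ennreal (ga t * r t) \<partial>lborel)"
proof -
  have "(\<integral>\<^sup>+x. ennreal (ridge_mult g a r x) \<partial>lborel) = (\<integral>\<^sup>+x. ennreal (r (a \<bullet> x)) \<partial>law g)"
    by (simp add: ridge_mult_def nn_integral_density ennreal_mult' prob_density_nonneg[OF g])
  also have "\<dots> = (\<integral>\<^sup>+t. ennreal (r t) \<partial>law ga)"
    by (subst nn_integral_law_proj_density[OF g a]) simp_all
  also have "\<dots> = (\<integral>\<^sup>+t. ennreal (ga t * r t) \<partial>lborel)"
    by (simp add: nn_integral_density ennreal_mult' proj_density_nonneg)
  finally show ?thesis .
qed

lemma proj_ratio_in_ridge_class: "\<rho> \<in> ridge_class g a"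
proof -
  \<comment> \<open>Where \<open>ga\<close> vanishes the product is 0; this agrees with
    \<open>fa\<close>, which vanishes there too up to a null set.\<close>
  have "AE t in lborel. ga t * \<rho> t = fa t"
    using AE_ga_pos[unfolded AE_law_iff[OF measurable_proj_density]]
  proof eventually_elim
    case (elim t)
    then show ?case
      using proj_density_nonneg[of f a t] by (cases "fa t = 0") (auto simp: proj_ratio_def)
  qed
  then have "(\<integral>\<^sup>+t. ennreal (ga t * \<rho> t) \<partial>lborel) = (\<integral>\<^sup>+t. ennreal (fa t) \<partial>lborel)"
    by (intro nn_integral_cong_AE) (auto elim: eventually_mono)
  then have "(\<integral>\<^sup>+x. ennreal (ridge_mult g a \<rho> x) \<partial>lborel) = 1"
    by (simp add: nn_integral_ridge_mult prob_density_nn_integral[OF fa])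
  moreover have "ridge_mult g a \<rho> \<in> borel_measurable borel"
    unfolding ridge_mult_def by measurable
  ultimately show ?thesis
    by (simp add: ridge_class_def prob_density_def proj_ratio_nonneg)
      (simp add: ridge_mult_def proj_ratio_nonneg prob_density_nonneg[OF g])
qed

lemma prob_density_ridge_mult: "r \<in> ridge_class g a \<Longrightarrow> prob_density (ridge_mult g a r)"
  by (simp add: ridge_class_def)

lemma AE_ridge_mult_pos: "AE x in law f. 0 < ridge_mult g a \<rho> x"
  using AE_g_pos AE_proj_ratio_pos by eventually_elim (simp add: ridge_mult_def)

lemma AE_log_ratio_split:
  "AE x in law f. ln (f x / g x) = ln (\<rho> (a \<bullet> x)) + ln (f x / ridge_mult g a \<rho> x)"
  using AE_g_pos AE_proj_ratio_pos AE_law_pos[OF prob_density_measurable[OF f]]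
  by eventually_elim (simp add: ridge_mult_def ln_div ln_mult)

lemma measurable_ridge_mult:
  "r \<in> borel_measurable borel \<Longrightarrow> ridge_mult g a r \<in> borel_measurable borel"
  unfolding ridge_mult_def by simp

lemma integrable_log_proj_ratio: "integrable (law f) (\<lambda>x. ln (\<rho> (a \<bullet> x)))"
proof (rule integrableI_bounded)
  let ?v = "\<lambda>x. ln (f x / g x)" and ?u = "\<lambda>x. ln (\<rho> (a \<bullet> x))"
    and ?w = "\<lambda>x. ln (f x / ridge_mult g a \<rho> x)"
  note [measurable] = measurable_ridge_mult[OF measurable_proj_ratio]
  have neg_u: "(\<integral>\<^sup>+x. ennreal (- ?u x) \<partial>law f) \<le> 1"
    using nn_integral_neg_log_ratio_le[OF fa ga]
    by (subst (asm) nn_integral_law_proj_density[OF f a]) (simp_all add: proj_ratio_def)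
  have neg_w: "(\<integral>\<^sup>+x. ennreal (- ?w x) \<partial>law f) \<le> 1"
    by (intro nn_integral_neg_log_ratio_le f prob_density_ridge_mult proj_ratio_in_ridge_class)
  \<comment> \<open>Almost everywhere \<open>?u = ?v - ?w\<close>. Where \<open>?u\<close> is
    negative its modulus is its negative part; elsewhere \<open>?u\<close> is at most
    \<open>norm ?v\<close> plus the negative part of \<open>?w\<close>.\<close>
  have "(\<integral>\<^sup>+x. ennreal (norm (?u x)) \<partial>law f)
    \<le> (\<integral>\<^sup>+x. ennreal (- ?u x) + (ennreal (norm (?v x)) + ennreal (- ?w x)) \<partial>law f)"
  proof (rule nn_integral_mono_AE)
    show "AE x in law f. ennreal (norm (?u x))
      \<le> ennreal (- ?u x) + (ennreal (norm (?v x)) + ennreal (- ?w x))"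
      using AE_log_ratio_split
    proof eventually_elim
      case (elim x)
      have "ennreal (norm (?u x)) \<le> ennreal (max 0 (- ?u x) + (norm (?v x) + max 0 (- ?w x)))"
        by (rule ennreal_leI) (use elim in auto)
      also have "\<dots> = ennreal (- ?u x) + (ennreal (norm (?v x)) + ennreal (- ?w x))"
        by (simp add: max_def ennreal_neg)
      finally show ?case .
    qed
  qed
  also have "\<dots> = (\<integral>\<^sup>+x. ennreal (- ?u x) \<partial>law f)
      + ((\<integral>\<^sup>+x. ennreal (norm (?v x)) \<partial>law f) + (\<integral>\<^sup>+x. ennreal (- ?w x) \<partial>law f))"
    by (simp add: nn_integral_add)
  also have "\<dots> < \<infinity>"
    using le_less_trans[OF neg_u ennreal_one_less_top] le_less_trans[OF neg_w ennreal_one_less_top]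
      integrable_log_ratio
    by (simp add: integrable_iff_bounded)
  finally show "(\<integral>\<^sup>+x. ennreal (norm (?u x)) \<partial>law f) < \<infinity>" .
qed simp

lemma integrable_log_ridge_ratio: "integrable (law f) (\<lambda>x. ln (f x / ridge_mult g a \<rho> x))"
proof -
  note [measurable] = measurable_ridge_mult[OF measurable_proj_ratio]
  have "integrable (law f) (\<lambda>x. ln (f x / g x) - ln (\<rho> (a \<bullet> x)))"
    by (intro Bochner_Integration.integrable_diff integrable_log_ratio integrable_log_proj_ratio)
  then show ?thesis
    by (rule integrable_cong_AE_imp) (simp, use AE_log_ratio_split in eventually_elim, simp)
qed

lemma KL_ridge_mult_proj_ratio:
  "KL f (ridge_mult g a \<rho>) = ereal (\<integral>x. ln (f x / ridge_mult g a \<rho> x) \<partial>law f)"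
  by (intro KL_eq_integral f prob_density_ridge_mult proj_ratio_in_ridge_class AE_ridge_mult_pos
      integrable_log_ridge_ratio)

text \<open>All three divergences are finite integrals: the one for \<open>fa\<close> and
  \<open>ga\<close> is pulled back to \<open>law f\<close> along \<open>a \<bullet> x\<close>, and
  \<open>AE_log_ratio_split\<close> adds the other two.\<close>

lemma KL_chain_rule: "KL f g = KL fa ga + KL f (ridge_mult g a \<rho>)"
proof -
  note [measurable] = measurable_ridge_mult[OF measurable_proj_ratio]
  have int: "integrable (law fa) (\<lambda>t. ln (fa t / ga t))"
    using integrable_log_proj_ratio unfolding law_proj_density[OF f a]
    by (subst integrable_distr_eq) (simp_all add: proj_ratio_def)
  have "KL fa ga = ereal (\<integral>t. ln (fa t / ga t) \<partial>law fa)"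
    by (intro KL_eq_integral fa ga AE_ga_pos int)
  also have "\<dots> = ereal (\<integral>x. ln (\<rho> (a \<bullet> x)) \<partial>law f)"
    by (subst integral_law_proj_density[OF f a]) (simp_all add: proj_ratio_def)
  finally have KL_fa: "KL fa ga = ereal (\<integral>x. ln (\<rho> (a \<bullet> x)) \<partial>law f)" .
  have "(\<integral>x. ln (f x / g x) \<partial>law f)
      = (\<integral>x. ln (\<rho> (a \<bullet> x)) + ln (f x / ridge_mult g a \<rho> x) \<partial>law f)"
    by (intro integral_cong_AE AE_log_ratio_split) simp_all
  also have "\<dots> = (\<integral>x. ln (\<rho> (a \<bullet> x)) \<partial>law f)
      + (\<integral>x. ln (f x / ridge_mult g a \<rho> x) \<partial>law f)"
    by (intro Bochner_Integration.integral_add integrable_log_proj_ratio integrable_log_ridge_ratio)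
  finally show ?thesis
    by (simp add: KL_fa KL_ridge_mult_proj_ratio
        KL_eq_integral[OF f g AE_g_pos integrable_log_ratio])
qed

section \<open>Minimality and uniqueness of the ratio of marginals\<close>

lemma
  assumes r: "r \<in> ridge_class g a"
  shows KL_ridge_mult_minimal: "KL f (ridge_mult g a \<rho>) \<le> KL f (ridge_mult g a r)"
    and AE_eq_proj_ratio_if_minimal:
      "KL f (ridge_mult g a r) \<le> KL f (ridge_mult g a \<rho>) \<Longrightarrow> AE x in law f. r (a \<bullet> x) = \<rho> (a \<bullet> x)"
proof -
  have [measurable]: "r \<in> borel_measurable borel" and r_nonneg: "\<And>t. 0 \<le> r t"
    using r by (auto simp: ridge_class_def)
  note [measurable] = measurable_ridge_mult[of r] measurable_ridge_mult[of \<rho>]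
  interpret F: prob_space "law f"
    by (rule prob_space_law[OF f])
  let ?s = "\<lambda>x. r (a \<bullet> x) / \<rho> (a \<bullet> x)"
  let ?w = "\<lambda>x. ln (f x / ridge_mult g a \<rho> x)" and ?wr = "\<lambda>x. ln (f x / ridge_mult g a r x)"
  have "(\<integral>\<^sup>+x. ennreal (?s x) \<partial>law f) = (\<integral>\<^sup>+t. ennreal (r t / \<rho> t) \<partial>law fa)"
    by (subst nn_integral_law_proj_density[OF f a]) simp_all
  also have "\<dots> = (\<integral>\<^sup>+t. ennreal (fa t * (r t / \<rho> t)) \<partial>lborel)"
    by (simp add: nn_integral_density ennreal_mult'[symmetric] proj_density_nonneg)
  \<comment> \<open>Equality holds where \<open>fa\<close> and \<open>ga\<close> are both positive.
    Elsewhere the left integrand is 0, by division by zero when \<open>ga\<close> or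
    \<open>\<rho>\<close> vanishes.\<close>
  also have "\<dots> \<le> (\<integral>\<^sup>+t. ennreal (ga t * r t) \<partial>lborel)"
    by (intro nn_integral_mono ennreal_leI)
      (auto simp: proj_ratio_def proj_density_nonneg r_nonneg)
  also have "\<dots> = 1"
    using prob_density_nn_integral[OF prob_density_ridge_mult[OF r]]
    by (simp add: nn_integral_ridge_mult)
  finally have s_le: "(\<integral>\<^sup>+x. ennreal (?s x) \<partial>law f) \<le> 1" .
  have s_nonneg: "0 \<le> ?s x" for x
    by (simp add: r_nonneg proj_ratio_nonneg)
  have int_s: "integrable (law f) ?s"
    using s_le s_nonneg by (intro integrableI_nonneg) (auto intro: le_less_trans)
  have "ennreal (\<integral>x. ?s x \<partial>law f) \<le> 1"
    using s_le by (simp add: nn_integral_eq_integral[OF int_s] s_nonneg)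
  then have s_le_1: "(\<integral>x. ?s x \<partial>law f) \<le> 1"
    by simp
  \<comment> \<open>An infinite value at \<open>r\<close> makes the inequality trivial and
    contradicts minimality, because the value at \<open>\<rho>\<close> is finite.\<close>
  have finite_case: "KL f (ridge_mult g a \<rho>) \<le> KL f (ridge_mult g a r) \<and>
      (KL f (ridge_mult g a r) \<le> KL f (ridge_mult g a \<rho>) \<longrightarrow> (AE x in law f. ?s x = 1))"
    if "KL f (ridge_mult g a r) < \<infinity>"
  proof -
    from that have pos: "AE x in law f. 0 < ridge_mult g a r x" and int_wr: "integrable (law f) ?wr"
      unfolding KL_less_infinity_iff[OF f prob_density_ridge_mult[OF r]] by simp_all
    have KL_r: "KL f (ridge_mult g a r) = ereal (\<integral>x. ?wr x \<partial>law f)"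
      by (intro KL_eq_integral f prob_density_ridge_mult r pos int_wr)
    have s_pos: "AE x in law f. 0 < ?s x"
      using AE_proj_ratio_pos pos AE_g_pos
      by eventually_elim (simp add: ridge_mult_def zero_less_mult_iff)
    have ln_s: "AE x in law f. ?w x - ?wr x = ln (?s x)"
      using AE_proj_ratio_pos pos AE_g_pos AE_law_pos[OF prob_density_measurable[OF f]]
      by eventually_elim (simp add: ridge_mult_def zero_less_mult_iff ln_div ln_mult)
    \<comment> \<open>Almost everywhere this is \<open>?s - 1 - ln ?s\<close>, which is nonnegative
      and vanishes only at \<open>?s = 1\<close>. As \<open>?s\<close> has integral at most 1, the
      integral of \<open>?d\<close> is at most the divergence at \<open>r\<close> minus the one at
      \<open>\<rho>\<close>.\<close>
    let ?d = "\<lambda>x. ?s x - 1 - (?w x - ?wr x)"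
    have int_d: "integrable (law f) ?d"
      by (intro Bochner_Integration.integrable_diff int_s int_wr integrable_log_ridge_ratio) simp
    have d_nonneg: "AE x in law f. 0 \<le> ?d x"
      using s_pos ln_s by eventually_elim (use ln_le_minus_one in auto)
    have int_d_eq: "(\<integral>x. ?d x \<partial>law f)
        = (\<integral>x. ?s x \<partial>law f) - 1 - ((\<integral>x. ?w x \<partial>law f) - (\<integral>x. ?wr x \<partial>law f))"
      using int_s int_wr integrable_log_ridge_ratio F.prob_space by simp
    have "0 \<le> (\<integral>x. ?d x \<partial>law f)"
      using d_nonneg by (rule integral_nonneg_AE)
    moreover have "AE x in law f. ?s x = 1" if "(\<integral>x. ?wr x \<partial>law f) \<le> (\<integral>x. ?w x \<partial>law f)"
    proof -
      have "(\<integral>x. ?d x \<partial>law f) = 0"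
        using that calculation s_le_1 int_d_eq by linarith
      then have "AE x in law f. ?d x = 0"
        by (simp add: integral_nonneg_eq_0_iff_AE[OF int_d d_nonneg])
      then show ?thesis
        using s_pos ln_s by eventually_elim (rule ln_eq_minus_one, simp_all)
    qed
    ultimately show ?thesis
      using s_le_1 int_d_eq by (simp add: KL_r KL_ridge_mult_proj_ratio)
  qed
  show "KL f (ridge_mult g a \<rho>) \<le> KL f (ridge_mult g a r)"
    using finite_case by (cases "KL f (ridge_mult g a r) < \<infinity>") auto
  show "AE x in law f. r (a \<bullet> x) = \<rho> (a \<bullet> x)"
    if le: "KL f (ridge_mult g a r) \<le> KL f (ridge_mult g a \<rho>)"
  proof -
    have "KL f (ridge_mult g a r) < \<infinity>"
      using le by (auto simp: KL_ridge_mult_proj_ratio)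
    with finite_case le have "AE x in law f. ?s x = 1"
      by blast
    \<comment> \<open>A quotient equal to 1 has a nonzero denominator, since division by 0 yields
      0.\<close>
    then show ?thesis
      by eventually_elim (auto split: if_splits)
  qed
qed

text \<open>Agreement under \<open>law f\<close> says nothing about \<open>r\<close> where
  \<open>fa\<close> vanishes. Normalisation settles that region: \<open>ga t * r t\<close> dominates
  \<open>fa t\<close> and has the same integral, so the two coincide almost everywhere.\<close>

lemma AE_eq_proj_ratio:
  assumes r: "r \<in> ridge_class g a" and eq: "AE x in law f. r (a \<bullet> x) = \<rho> (a \<bullet> x)"
  shows "AE t in law ga. r t = \<rho> t"
proof -
  have [measurable]: "r \<in> borel_measurable borel" and r_nonneg: "\<And>t. 0 \<le> r t"
    using r by (auto simp: ridge_class_def)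
  have "AE t in law fa. r t = \<rho> t"
    using eq by (subst AE_law_proj_density_iff[OF f a]) simp_all
  then have le: "AE t in lborel. fa t \<le> ga t * r t"
    using AE_ga_pos unfolding AE_law_iff[OF measurable_proj_density]
  proof eventually_elim
    case (elim t)
    show ?case
    proof (cases "0 < fa t")
      case True
      then show ?thesis using elim by (simp add: proj_ratio_def)
    next
      case False
      then have "fa t = 0"
        using proj_density_nonneg[of f a t] by linarith
      then show ?thesis by (simp add: proj_density_nonneg r_nonneg)
    qed
  qed
  \<comment> \<open>Subtraction in \<open>ennreal\<close> truncates at 0, so a zero difference alone
    gives only one inequality; \<open>le\<close> supplies the other.\<close>
  have "(\<integral>\<^sup>+t. ennreal (ga t * r t) - ennreal (fa t) \<partial>lborel)
      = (\<integral>\<^sup>+t. ennreal (ga t * r t) \<partial>lborel) - (\<integral>\<^sup>+t. ennreal (fa t) \<partial>lborel)"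
    using le by (intro nn_integral_diff)
      (auto simp: prob_density_nn_integral[OF fa] elim!: eventually_mono intro: ennreal_leI)
  also have "\<dots> = 0"
    using prob_density_nn_integral[OF prob_density_ridge_mult[OF r]]
    by (simp add: nn_integral_ridge_mult prob_density_nn_integral[OF fa])
  finally have "AE t in lborel. ennreal (ga t * r t) - ennreal (fa t) = 0"
    by (subst (asm) nn_integral_0_iff_AE) simp_all
  with le have "AE t in lborel. ga t * r t = fa t"
    by eventually_elim (auto simp: ennreal_minus proj_density_nonneg ennreal_eq_0_iff)
  then show ?thesis
    unfolding AE_law_iff[OF measurable_proj_density]
    by eventually_elim (auto simp: proj_ratio_def field_simps)
qed

text \<open>As \<open>\<rho>\<close> belongs to the class and attains the minimum, comparison with
  it alone decides minimality.\<close>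

lemma is_arg_min_ridge_class_iff:
  "is_arg_min (\<lambda>r. KL f (ridge_mult g a r)) (\<lambda>r. r \<in> ridge_class g a) r \<longleftrightarrow>
    r \<in> ridge_class g a \<and> KL f (ridge_mult g a r) \<le> KL f (ridge_mult g a \<rho>)"
  using KL_ridge_mult_minimal proj_ratio_in_ridge_class
  by (auto simp: is_arg_min_linorder intro: order_trans)

end

theorem proposition6:
  fixes f g :: "real ^ 'n \<Rightarrow> real"
  assumes "prob_density f" and "elliptical_density g"
    and "finite_variance f" and "finite_variance g"
    and "mean g = mean f" and "covariance g = covariance f"
    and "KL f g < \<infinity>"
  shows "\<exists>a :: real ^ 'n. a \<noteq> 0 \<and>
    is_arg_min (\<lambda>r. KL f (ridge_mult g a r)) (\<lambda>r. r \<in> ridge_class g a) (proj_ratio f g a) \<and>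
    (\<forall>r. is_arg_min (\<lambda>r. KL f (ridge_mult g a r)) (\<lambda>r. r \<in> ridge_class g a) r \<longrightarrow>
       (AE t in law (proj_density g a). r t = proj_ratio f g a t) \<and>
       (AE x in law g. r (a \<bullet> x) = proj_density f a (a \<bullet> x) / proj_density g a (a \<bullet> x))) \<and>
    KL f g = KL (proj_density f a) (proj_density g a)
           + KL f (ridge_mult g a (proj_ratio f g a))"
proof -
  have g: "prob_density g"
    using assms(2) by (simp add: elliptical_density_def)
  \<comment> \<open>A coordinate unit vector serves as the witness; \<open>undefined\<close> picks
    some index, and only \<open>a \<noteq> 0\<close> is used.\<close>
  define a :: "real ^ 'n" where "a = axis undefined 1"
  have a: "a \<noteq> 0"
    by (simp add: a_def)
  interpret ridge_projection f g a
    by unfold_locales (rule assms g a)+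
  have unique: "(AE t in law ga. r t = \<rho> t) \<and> (AE x in law g. r (a \<bullet> x) = \<rho> (a \<bullet> x))"
    if "r \<in> ridge_class g a" "KL f (ridge_mult g a r) \<le> KL f (ridge_mult g a \<rho>)" for r
  proof -
    have [measurable]: "r \<in> borel_measurable borel"
      using that by (simp add: ridge_class_def)
    have "AE t in law ga. r t = \<rho> t"
      using that AE_eq_proj_ratio AE_eq_proj_ratio_if_minimal by blast
    moreover from this have "AE x in law g. r (a \<bullet> x) = \<rho> (a \<bullet> x)"
      by (subst (asm) AE_law_proj_density_iff[OF g a]) simp_all
    ultimately show ?thesis ..
  qed
  show ?thesis
    using a proj_ratio_in_ridge_class KL_chain_rule unique
    by (intro exI[of _ a]) (simp add: is_arg_min_ridge_class_iff proj_ratio_def)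
qed

end
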